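(* For every integer $q \geq 2$, \[ \mathbb{I}(Z_3,q) = \sum_{\ell = 1}^{\infty} a_\ell \left(\sum_{i = 0}^{\infty}\big(G_\ell(i) + H_\ell(i)\big)\right), \] where $a_\ell$ is the number of bifix-free words of length $\ell$ over $[q]$, and \begin{align*} G_\ell(i) &= \frac{ (-1)^i\, r_\ell\!\left(q^{-2^{i+1}}\right) \prod_{j = 0}^{i-1} s_\ell\!\left(q^{-2^{j+1}}\right)}{ \prod_{k = 0}^i \left(1 - q^{1-2^{k+1}}\right)}, & r_\ell(x) &= qx^{2\ell+1} - x^{4\ell} + x^{5\ell} - qx^{5\ell+1} +x^{6\ell}, \\ s_\ell(x) &= 1 - qx^{1-\ell} + x^{-\ell}, & H_\ell(i) &= \frac{ (-1)^i\, u_\ell\!\left(q^{-2^{i+1}}\right) \prod_{j = 0}^{i-1} v_\ell\!\left(q^{-2^{j+1}}\right) }{ \prod_{k = 0}^i \left(1 - q^{1-2^{k+1}}\right)}, \\ u_\ell(x) &= qx^{4\ell+1} - x^{5\ell} + qx^{5\ell+1} - x^{6\ell}, & v_\ell(x) &= 1 - qx^{1-\ell} + x^{-\ell} - qx^{1-2\ell} + x^{-2\ell}. \end{align*}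
   Context: $[q]=\{1,\dots,q\}$. A nonempty word $V$ is a bifix of a word $W$ if $W = VA = BV$ for nonempty words $A,B$; a word is bifix-free if it has no bifix. $Z_3 = abacaba$; a word $U$ is an instance of $Z_3$ if $U = XYXZXYX$ for some nonempty words $X,Y,Z$. $\mathbb{I}_n(Z_3,q)$ is the probability that a uniformly random word in $[q]^n$ is an instance of $Z_3$, and $\mathbb{I}(Z_3,q)=\lim_{n\to\infty}\mathbb{I}_n(Z_3,q)$ (this limit exists). *)

theory Defs
  imports "HOL-Probability.Probability"
begin

definition words :: "nat \<Rightarrow> nat \<Rightarrow> nat list set" where
  "words q n = {w \<in> lists {1..q}. length w = n}"

definition bifix :: "'a list \<Rightarrow> 'a list \<Rightarrow> bool" where
  "bifix V W \<longleftrightarrow>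
     V \<noteq> [] \<and> (\<exists>A B. A \<noteq> [] \<and> B \<noteq> [] \<and> W = V @ A \<and> W = B @ V)"

definition bifix_free :: "'a list \<Rightarrow> bool" where
  "bifix_free W \<longleftrightarrow> \<not> (\<exists>V. bifix V W)"

definition Z3_instance :: "'a list \<Rightarrow> bool" where
  "Z3_instance U \<longleftrightarrow>
     (\<exists>X Y Z. X \<noteq> [] \<and> Y \<noteq> [] \<and> Z \<noteq> [] \<and> U = X @ Y @ X @ Z @ X @ Y @ X)"

definition Z3_prob :: "nat \<Rightarrow> nat \<Rightarrow> real" where
  "Z3_prob q n = measure_pmf.prob (pmf_of_set (words q n)) {U. Z3_instance U}"

definition Z3_density :: "nat \<Rightarrow> real" where
  "Z3_density q = lim (Z3_prob q)"

definition num_bifix_free :: "nat \<Rightarrow> nat \<Rightarrow> nat" where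
  "num_bifix_free q l = card {w \<in> words q l. bifix_free w}"

definition r_fun :: "nat \<Rightarrow> nat \<Rightarrow> real \<Rightarrow> real" where
  "r_fun q l x =
     real q * x ^ (2*l+1) - x ^ (4*l) + x ^ (5*l) - real q * x ^ (5*l+1) + x ^ (6*l)"

definition s_fun :: "nat \<Rightarrow> nat \<Rightarrow> real \<Rightarrow> real" where
  "s_fun q l x = 1 - real q * x powi (1 - int l) + x powi (- int l)"

definition u_fun :: "nat \<Rightarrow> nat \<Rightarrow> real \<Rightarrow> real" where
  "u_fun q l x =
     real q * x ^ (4*l+1) - x ^ (5*l) + real q * x ^ (5*l+1) - x ^ (6*l)"

definition v_fun :: "nat \<Rightarrow> nat \<Rightarrow> real \<Rightarrow> real" where
  "v_fun q l x =
     1 - real q * x powi (1 - int l) + x powi (- int l)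
       - real q * x powi (1 - 2 * int l) + x powi (- 2 * int l)"

definition G_term :: "nat \<Rightarrow> nat \<Rightarrow> nat \<Rightarrow> real" where
  "G_term q l i =
     ((-1) ^ i * r_fun q l (real q powi (- (2 ^ (i+1))))
        * (\<Prod>j<i. s_fun q l (real q powi (- (2 ^ (j+1))))))
     / (\<Prod>k\<le>i. 1 - real q powi (1 - 2 ^ (k+1)))"

definition H_term :: "nat \<Rightarrow> nat \<Rightarrow> nat \<Rightarrow> real" where
  "H_term q l i =
     ((-1) ^ i * u_fun q l (real q powi (- (2 ^ (i+1))))
        * (\<Prod>j<i. v_fun q l (real q powi (- (2 ^ (j+1))))))
     / (\<Prod>k\<le>i. 1 - real q powi (1 - 2 ^ (k+1)))"

end

theory Submission
  imports Defs "HOL-Library.Sublist" "HOL-Real_Asymp.Real_Asymp"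
begin

text \<open>
  Every instance of \<open>abacaba\<close> over \<open>[q]\<close> can be written in exactly one way as \<open>V Z V\<close> with \<open>V\<close> a minimal
  instance of \<open>aba\<close>, that is, one with no bifix that is again an instance of \<open>aba\<close>. Hence the
  probability for length \<open>n\<close> is the sum of \<open>q\<^bsup>-2|V|\<^esup>\<close> over the minimal \<open>V\<close> with \<open>2|V| < n\<close>, and
  the limit is the generating function of the minimal instances of \<open>aba\<close> at \<open>x = q\<^bsup>-2\<^esup>\<close>.

  Sort the minimal \<open>V\<close> by their unique bifix-free bifix \<open>L\<close>, of length \<open>\<ell>\<close>. A word longer than \<open>2\<ell>\<close>
  which starts and ends with \<open>L\<close> is either minimal, or of the form \<open>V Z V\<close> with \<open>V\<close> minimal, or two
  copies of a minimal \<open>V\<close> overlapping in a bifix of \<open>V\<close>; the only bifixes of a minimal \<open>V\<close> are \<open>L\<close> and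
  possibly \<open>L L\<close>. Treating the words with and without the bifix \<open>L L\<close> separately, the generating
  function \<open>f\<close> of each kind satisfies \<open>f(x) = R(x) - S(x) f(x\<^sup>2)\<close>, and iterating this equation
  gives the two series.
\<close>

section \<open>Bifixes and minimal words\<close>

lemma bifix_iff:
  "bifix V W \<longleftrightarrow> V \<noteq> [] \<and> prefix V W \<and> suffix V W \<and> length V < length W"
proof
  assume "bifix V W"
  then show "V \<noteq> [] \<and> prefix V W \<and> suffix V W \<and> length V < length W"
    unfolding bifix_def prefix_def suffix_def by auto
next
  assume V: "V \<noteq> [] \<and> prefix V W \<and> suffix V W \<and> length V < length W"
  then obtain A B where AB: "W = V @ A" "W = B @ V"
    unfolding prefix_def suffix_def by blast
  then have "length W = length V + length A" "length W = length B + length V"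
    by (metis length_append)+
  then have "A \<noteq> []" "B \<noteq> []" using V by auto
  then show "bifix V W"
    using V AB unfolding bifix_def by blast
qed

lemma bifix_length: "bifix V W \<Longrightarrow> length V < length W"
  by (simp add: bifix_iff)

lemma bifix_trans: "bifix U V \<Longrightarrow> bifix V W \<Longrightarrow> bifix U W"
  by (auto simp: bifix_iff intro: prefix_order.trans suffix_order.trans)

text \<open>Prefixes of one word are comparable, and so are its suffixes; hence the bifixes of a
  fixed word form a chain under \<open>bifix\<close>. The uniqueness arguments below rest on
  this.\<close>

lemma bifix_of_bifix:
  assumes "bifix U W" "bifix V W" "length U < length V"
  shows "bifix U V"
  using assms by (auto simp: bifix_iff intro: prefix_length_prefix suffix_length_suffix)

lemma bifix_eq_if_length_eq:
  assumes "bifix U W" "bifix V W" "length U = length V"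
  shows "U = V"
  using assms by (metis bifix_iff prefix_length_prefix prefix_order.antisym order_refl)

lemma bifix_in_lists: "bifix V W \<Longrightarrow> W \<in> lists A \<Longrightarrow> V \<in> lists A"
  by (auto simp: bifix_def)

section \<open>Minimal words with respect to the bifix order\<close>

definition minimal_words :: "'a list set \<Rightarrow> 'a list set" where
  "minimal_words K = {V \<in> K. \<forall>U\<in>K. \<not> bifix U V}"

text \<open>Under this closure the words of \<open>K\<close> outside \<open>minimal_words K\<close>
  are exactly the words over \<open>A\<close> with a bifix in \<open>minimal_words K\<close>. The
  set \<open>K\<close> is left general because the functional equation is needed for
  \<open>D\<close> and for \<open>C - D\<close>.\<close>

definition bifix_closed :: "'a set \<Rightarrow> 'a list set \<Rightarrow> bool" where
  "bifix_closed A K \<longleftrightarrow> K \<subseteq> lists A \<and> [] \<notin> K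
     \<and> (\<forall>V\<in>K. \<forall>W\<in>lists A. bifix V W \<longrightarrow> W \<in> K)"

lemma minimal_words_subset: "minimal_words K \<subseteq> K"
  by (auto simp: minimal_words_def)

lemma ex_minimal_bifix:
  "W \<in> K \<Longrightarrow> W \<notin> minimal_words K \<Longrightarrow> \<exists>V\<in>minimal_words K. bifix V W"
proof (induction "length W" arbitrary: W rule: less_induct)
  case less
  then obtain U where U: "U \<in> K" "bifix U W"
    by (auto simp: minimal_words_def)
  show ?case
  proof (cases "U \<in> minimal_words K")
    case False
    then show ?thesis
      using less.hyps[of U] U bifix_length bifix_trans by blast
  qed (use U in auto)
qed

text \<open>Of two different bifixes of \<open>W\<close> the shorter is a bifix of the longer, which
  is then not minimal.\<close>

lemma minimal_bifix_unique:
  assumes "V \<in> minimal_words K" "V' \<in> minimal_words K" "bifix V W" "bifix V' W"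
  shows "V = V'"
  using assms bifix_of_bifix[of V W V'] bifix_of_bifix[of V' W V] bifix_eq_if_length_eq[of V W V']
  unfolding minimal_words_def by (metis (no_types, lifting) linorder_neqE_nat mem_Collect_eq)

lemma bifix_sandwich: "V \<noteq> [] \<Longrightarrow> bifix V (V @ Z @ V)"
  by (auto simp: bifix_iff prefix_def suffix_def)

lemma bifix_overlap:
  assumes "bifix U V"
  shows "bifix V (V @ drop (length U) V)"
proof -
  from assms obtain A B where AB: "A \<noteq> []" "V = U @ A" "V = B @ U" "V \<noteq> []"
    by (auto simp: bifix_def)
  then have "V @ drop (length U) V = B @ V"
    by (metis append_eq_conv_conj append.assoc)
  moreover have "length (drop (length U) V) > 0" using bifix_length[OF assms] by simp
  ultimately show ?thesis
    using AB(4) unfolding bifix_iff by (metis length_append less_add_same_cancel1 prefixI suffixI)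
qed

text \<open>The copies of \<open>V\<close> at the two ends of \<open>W\<close> are either disjoint
  or share a nonempty word \<open>U\<close>, which is then a bifix of \<open>V\<close>.\<close>

lemma bifix_cases:
  assumes "bifix V W"
  obtains (sandwich) Z where "W = V @ Z @ V"
  | (overlap) U where "bifix U V" "W = V @ drop (length U) V"
proof -
  from assms obtain A B where AB: "A \<noteq> []" "B \<noteq> []" "W = V @ A" "W = B @ V" "V \<noteq> []"
    by (auto simp: bifix_def)
  from AB(3,4) consider us where "V @ us = B" "A = us @ V" | us where "V = B @ us" "us @ A = V"
    by (metis append_eq_append_conv2)
  then show thesis
  proof cases
    case 1
    then show ?thesis using AB(3) sandwich by blast
  next
    case 2
    show ?thesis
    proof (cases "us = []")
      \<comment> \<open>Adjacent copies count as a sandwich with empty middle word.\<close>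
      case True
      then have "W = V @ [] @ V" using 2 AB(4) by simp
      then show ?thesis by (rule sandwich)
    next
      case False
      then have "bifix us V" using 2 AB(1,2) unfolding bifix_def by metis
      moreover have "W = V @ drop (length us) V" using 2(2) AB(3) by (metis append_eq_conv_conj)
      ultimately show ?thesis by (rule overlap)
    qed
  qed
qed

lemma inj_on_sandwich:
  assumes "[] \<notin> K"
  shows "inj_on (\<lambda>(V, Z). V @ Z @ V) (minimal_words K \<times> UNIV)"
proof (rule inj_onI, clarify)
  fix V Z V' Z' assume V: "V \<in> minimal_words K" "V' \<in> minimal_words K"
    and eq: "V @ Z @ V = V' @ Z' @ V'"
  have "V \<noteq> []" "V' \<noteq> []" using V assms by (auto simp: minimal_words_def)
  then have "V = V'"
    using minimal_bifix_unique[OF V bifix_sandwich[of V Z]] bifix_sandwich[of V' Z'] eq by auto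
  then show "V = V' \<and> Z = Z'" using eq by auto
qed

text \<open>A non-minimal word determines its minimal bifix \<open>V\<close>, and then
  \<open>Z\<close> or \<open>t\<close>. A bifix of \<open>V\<close> is fixed by its length, so the
  overlaps can be indexed by \<open>T\<close>; since \<open>T\<close> is the same for all minimal
  \<open>V\<close>, both families range over product sets.\<close>

lemma non_minimal_decomposition:
  assumes K: "bifix_closed A K"
    and T: "\<And>V. V \<in> minimal_words K \<Longrightarrow> length ` {U. bifix U V} = T"
  defines "M \<equiv> minimal_words K"
  shows "inj_on (\<lambda>(V, Z). V @ Z @ V) (M \<times> lists A)"
    and "inj_on (\<lambda>(V, t). V @ drop t V) (M \<times> T)"
    and "(\<lambda>(V, Z). V @ Z @ V) ` (M \<times> lists A) \<inter> (\<lambda>(V, t). V @ drop t V) ` (M \<times> T) = {}"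
    and "(\<lambda>(V, Z). V @ Z @ V) ` (M \<times> lists A) \<union> (\<lambda>(V, t). V @ drop t V) ` (M \<times> T) = K - M"
proof -
  have M: "V \<noteq> []" "V \<in> K" "V \<in> lists A" if "V \<in> M" for V
    using that K by (auto simp: M_def minimal_words_def bifix_closed_def)
  have sandwich: "bifix V (V @ Z @ V)" if "V \<in> M" for V Z
    using M[OF that] bifix_sandwich by auto
  have overlap: "bifix V (V @ drop t V)" and t_less: "0 < t \<and> t < length V"
    if "V \<in> M" "t \<in> T" for V t
  proof -
    from that T obtain U where "bifix U V" "t = length U" unfolding M_def by blast
    then show "bifix V (V @ drop t V)" "0 < t \<and> t < length V"
      using bifix_overlap by (auto simp: bifix_iff)
  qed
  have unique: "V = V'" if "V \<in> M" "V' \<in> M" "bifix V W" "bifix V' W" for V V' W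
    using that minimal_bifix_unique unfolding M_def by blast
  show "inj_on (\<lambda>(V, Z). V @ Z @ V) (M \<times> lists A)"
    by (rule inj_on_subset[OF inj_on_sandwich[of K]]) (use K in \<open>auto simp: bifix_closed_def M_def\<close>)
  show "inj_on (\<lambda>(V, t). V @ drop t V) (M \<times> T)"
  proof (rule inj_onI, clarify)
    fix V t V' t' assume V: "V \<in> M" "V' \<in> M" "t \<in> T" "t' \<in> T"
      and eq: "V @ drop t V = V' @ drop t' V'"
    have "V = V'" using unique[OF V(1,2) overlap[OF V(1,3)]] overlap[OF V(2,4)] eq by auto
    moreover have "t = t'"
      using arg_cong[OF eq, of length] t_less[OF V(1,3)] t_less[OF V(2,4)] \<open>V = V'\<close> by auto
    ultimately show "V = V' \<and> t = t'" by auto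
  qed
  show "(\<lambda>(V, Z). V @ Z @ V) ` (M \<times> lists A) \<inter> (\<lambda>(V, t). V @ drop t V) ` (M \<times> T) = {}"
  proof -
    have "V @ Z @ V \<noteq> V' @ drop t V'" if V: "V \<in> M" "V' \<in> M" "t \<in> T" for V V' Z t
    proof
      assume eq: "V @ Z @ V = V' @ drop t V'"
      have "V = V'" using unique[OF V(1,2) sandwich[OF V(1), of Z]] overlap[OF V(2,3)] eq by auto
      \<comment> \<open>A sandwich has length at least twice that of \<open>V\<close>, an overlap
        strictly less.\<close>
      then show False using arg_cong[OF eq, of length] t_less[OF V(2,3)] by auto
    qed
    then show ?thesis by auto
  qed
  show "(\<lambda>(V, Z). V @ Z @ V) ` (M \<times> lists A) \<union> (\<lambda>(V, t). V @ drop t V) ` (M \<times> T) = K - M"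
  proof (intro equalityI subsetI)
    fix W assume "W \<in> (\<lambda>(V, Z). V @ Z @ V) ` (M \<times> lists A) \<union> (\<lambda>(V, t). V @ drop t V) ` (M \<times> T)"
    then obtain V where V: "V \<in> M" "bifix V W" "W \<in> lists A"
    proof
      assume "W \<in> (\<lambda>(V, Z). V @ Z @ V) ` (M \<times> lists A)"
      then show thesis using that sandwich M(3) by fastforce
    next
      assume "W \<in> (\<lambda>(V, t). V @ drop t V) ` (M \<times> T)"
      then obtain V t where Vt: "V \<in> M" "t \<in> T" "W = V @ drop t V" by auto
      have "set W \<subseteq> set V" using Vt(3) set_drop_subset[of t V] by auto
      with M(3)[OF Vt(1)] have "W \<in> lists A" by auto
      then show thesis using that overlap Vt by auto
    qed
    then have "W \<in> K" using K M unfolding bifix_closed_def by blast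
    moreover have "W \<notin> M" using V M unfolding M_def minimal_words_def by blast
    ultimately show "W \<in> K - M" by blast
  next
    fix W assume W: "W \<in> K - M"
    then obtain V where V: "V \<in> M" "bifix V W" using ex_minimal_bifix unfolding M_def by blast
    have "W \<in> lists A" using W K by (auto simp: bifix_closed_def)
    from V(2) show "W \<in> (\<lambda>(V, Z). V @ Z @ V) ` (M \<times> lists A) \<union> (\<lambda>(V, t). V @ drop t V) ` (M \<times> T)"
    proof (cases rule: bifix_cases)
      case (sandwich Z)
      then have "Z \<in> lists A" using \<open>W \<in> lists A\<close> by auto
      then show ?thesis using V sandwich by force
    next
      case (overlap U)
      then have "length U \<in> T" using T[of V] V unfolding M_def by blast
      then show ?thesis using V overlap by force
    qed
  qed
qed

section \<open>Generating functions\<close>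

text \<open>A real value instead of a formal power series: the functional equation is evaluated at
  \<open>x\<close> and at its iterated squares. The unordered sum allows regrouping by subsets and
  along bijections.\<close>

definition word_gf :: "'a list set \<Rightarrow> real \<Rightarrow> real" where
  "word_gf S x = (\<Sum>\<^sub>\<infinity>w\<in>S. x ^ length w)"

lemma has_sum_lists:
  fixes A :: "'a set"
  assumes A: "finite A" and x: "0 \<le> x" "real (card A) * x < 1"
  shows "((\<lambda>w. x ^ length w) has_sum (1 / (1 - real (card A) * x))) (lists A)"
proof -
  let ?B = "\<lambda>n. {w. set w \<subseteq> A \<and> length w = n}"
  have "((\<lambda>(n, w). x ^ length w) has_sum (1 / (1 - real (card A) * x))) (Sigma UNIV ?B)"
  proof (rule has_sum_SigmaI)
    show 1: "((\<lambda>w. case (n, w) of (n, w) \<Rightarrow> x ^ length w) has_sum (real (card A) * x) ^ n) (?B n)" for n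
      using A by (intro has_sum_finiteI) (auto simp: finite_lists_length_eq card_lists_length_eq power_mult_distrib)
    show 2: "((\<lambda>n. (real (card A) * x) ^ n) has_sum (1 / (1 - real (card A) * x))) UNIV"
      using x by (intro norm_summable_imp_has_sum geometric_sums) (auto intro!: summable_geometric simp: norm_power norm_mult)
    show "(\<lambda>(n, w). x ^ length w) summable_on Sigma UNIV ?B"
      by (rule summable_on_SigmaI[OF 1]) (use 2 x in \<open>auto dest: has_sum_imp_summable\<close>)
  qed
  moreover have "bij_betw snd (Sigma UNIV ?B) (lists A)"
    by (intro bij_betwI[where g = "\<lambda>w. (length w, w)"]) (auto simp: lists_eq_set)
  ultimately show ?thesis
    by (subst has_sum_reindex_bij_betw[symmetric]) (auto simp: case_prod_unfold)
qed

lemma has_sum_word_gf: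
  assumes "finite A" "0 \<le> x" "real (card A) * x < 1" "S \<subseteq> lists A"
  shows "((\<lambda>w. x ^ length w) has_sum word_gf S x) S"
  unfolding word_gf_def
  using has_sum_lists[OF assms(1-3)] assms(4)
  by (meson has_sum_imp_summable has_sum_infsum summable_on_subset_banach)

lemma word_gf_mono:
  assumes "finite A" "0 \<le> x" "real (card A) * x < 1" "S \<subseteq> S'" "S' \<subseteq> lists A"
  shows "0 \<le> word_gf S x" "word_gf S x \<le> word_gf S' x"
proof -
  have S: "S \<subseteq> lists A" using assms by auto
  show "word_gf S x \<le> word_gf S' x"
    by (rule has_sum_mono'[OF has_sum_word_gf[OF assms(1-3) S] has_sum_word_gf[OF assms(1-3,5)]])
      (use assms in auto)
  show "0 \<le> word_gf S x"
    by (rule has_sum_nonneg[OF has_sum_word_gf[OF assms(1-3) S]]) (use assms in auto)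
qed

lemma word_gf_Un:
  assumes "finite A" "0 \<le> x" "real (card A) * x < 1" "S \<subseteq> lists A" "S' \<subseteq> lists A" "S \<inter> S' = {}"
  shows "word_gf (S \<union> S') x = word_gf S x + word_gf S' x"
  using has_sum_Un_disjoint[OF has_sum_word_gf[OF assms(1-4)] has_sum_word_gf[OF assms(1-3,5)] assms(6)]
  by (simp add: infsumI word_gf_def[of "S \<union> S'"])

text \<open>In \<open>V @ Z @ V\<close> the word \<open>V\<close> counts twice, so the minimal words
  enter at \<open>x\<^sup>2\<close> and the free middle \<open>Z\<close> contributes the geometric
  series. An overlap of length \<open>t\<close> saves \<open>t\<close> letters, hence the factor
  \<open>1 / x ^ t\<close>.\<close>

lemma word_gf_functional_equation:
  assumes A: "finite A" and x: "0 < x" "x \<le> 1" "real (card A) * x < 1"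
    and K: "bifix_closed A K" and fin: "finite T"
    and T: "\<And>V. V \<in> minimal_words K \<Longrightarrow> length ` {U. bifix U V} = T"
  shows "word_gf K x = word_gf (minimal_words K) x
    + word_gf (minimal_words K) (x\<^sup>2) * (1 / (1 - real (card A) * x) + (\<Sum>t\<in>T. 1 / x ^ t))"
proof -
  define M where "M = minimal_words K"
  note dec = non_minimal_decomposition[OF K T, folded M_def]
  have KA: "K \<subseteq> lists A" using K by (auto simp: bifix_closed_def)
  have MK: "M \<subseteq> K" unfolding M_def by (rule minimal_words_subset)
  have MA: "M \<subseteq> lists A" using MK KA by auto
  have x2: "0 \<le> x\<^sup>2" "real (card A) * x\<^sup>2 < 1"
  proof -
    have "x\<^sup>2 \<le> x" using x by (simp add: power2_eq_square mult_left_le)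
    then have "real (card A) * x\<^sup>2 \<le> real (card A) * x" by (intro mult_left_mono) auto
    then show "real (card A) * x\<^sup>2 < 1" using x by linarith
  qed auto
  have gM2: "((\<lambda>V. (x\<^sup>2) ^ length V) has_sum word_gf M (x\<^sup>2)) M"
    by (rule has_sum_word_gf[OF A x2 MA])
  have gl: "((\<lambda>Z. x ^ length Z) has_sum 1 / (1 - real (card A) * x)) (lists A)"
    by (rule has_sum_lists) (use A x in auto)
  have prod: "((\<lambda>(V, z). (x\<^sup>2) ^ length V * f z) has_sum word_gf M (x\<^sup>2) * c) (M \<times> B)"
    if f: "(f has_sum c) B" "\<And>z. z \<in> B \<Longrightarrow> 0 \<le> f z" for f :: "'z \<Rightarrow> real" and c B
  proof (rule has_sum_SigmaI)
    show 1: "((\<lambda>z. case (V, z) of (V, z) \<Rightarrow> (x\<^sup>2) ^ length V * f z) has_sum ((x\<^sup>2) ^ length V * c)) B" for V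
      using has_sum_cmult_right[OF f(1)] by simp
    show 2: "((\<lambda>V. (x\<^sup>2) ^ length V * c) has_sum word_gf M (x\<^sup>2) * c) M"
      using has_sum_cmult_left[OF gM2] by simp
    show "(\<lambda>(V, z). (x\<^sup>2) ^ length V * f z) summable_on (M \<times> B)"
      by (rule summable_on_SigmaI[OF 1]) (use 2 f x in \<open>auto dest: has_sum_imp_summable\<close>)
  qed
  have sandwiches: "((\<lambda>w. x ^ length w) has_sum word_gf M (x\<^sup>2) * (1 / (1 - real (card A) * x)))
      ((\<lambda>(V, Z). V @ Z @ V) ` (M \<times> lists A))"
  proof (subst has_sum_reindex[OF dec(1)])
    have "x ^ length (V @ Z @ V) = (x\<^sup>2) ^ length V * x ^ length Z" for V Z :: "'a list"
      by (simp add: power_add power2_eq_square power_mult_distrib)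
    then show "((\<lambda>w. x ^ length w) \<circ> (\<lambda>(V, Z). V @ Z @ V) has_sum
        word_gf M (x\<^sup>2) * (1 / (1 - real (card A) * x))) (M \<times> lists A)"
      using prod[OF gl] x by (simp add: o_def case_prod_unfold)
  qed
  have overlaps: "((\<lambda>w. x ^ length w) has_sum word_gf M (x\<^sup>2) * (\<Sum>t\<in>T. 1 / x ^ t))
      ((\<lambda>(V, t). V @ drop t V) ` (M \<times> T))"
  proof (subst has_sum_reindex[OF dec(2)])
    \<comment> \<open>A bifix is no longer than \<open>V\<close>, so the truncated subtraction in
      the length of \<open>drop t V\<close> is exact.\<close>
    have eq: "x ^ length (V @ drop t V) = (x\<^sup>2) ^ length V * (1 / x ^ t)" if V: "V \<in> M" "t \<in> T" for V t
    proof -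
      have "t \<in> length ` {U. bifix U V}" using T[of V] V by (auto simp: M_def)
      then have "t \<le> length V" by (auto simp: bifix_iff)
      then have "x ^ length (drop t V) * x ^ t = x ^ length V"
        by (simp flip: power_add)
      then have "x ^ length (drop t V) = x ^ length V / x ^ t"
        using x by (simp add: eq_divide_eq)
      then show ?thesis by (simp add: power_add power2_eq_square power_mult_distrib)
    qed
    have "((\<lambda>(V, t). (x\<^sup>2) ^ length V * (1 / x ^ t)) has_sum word_gf M (x\<^sup>2) * (\<Sum>t\<in>T. 1 / x ^ t)) (M \<times> T)"
      using fin x by (intro prod has_sum_finite) auto
    then show "((\<lambda>w. x ^ length w) \<circ> (\<lambda>(V, t). V @ drop t V) has_sum
        word_gf M (x\<^sup>2) * (\<Sum>t\<in>T. 1 / x ^ t)) (M \<times> T)"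
      by (rule has_sum_cong[THEN iffD1, rotated]) (use eq in \<open>auto simp: o_def\<close>)
  qed
  have "((\<lambda>w. x ^ length w) has_sum word_gf M (x\<^sup>2) * (1 / (1 - real (card A) * x))
      + word_gf M (x\<^sup>2) * (\<Sum>t\<in>T. 1 / x ^ t)) (K - M)"
    using has_sum_Un_disjoint[OF sandwiches overlaps dec(3)] dec(4) by (simp add: M_def)
  moreover have "((\<lambda>w. x ^ length w) has_sum word_gf M x) M"
    by (rule has_sum_word_gf[OF A _ _ MA]) (use x in auto)
  ultimately have "((\<lambda>w. x ^ length w) has_sum (word_gf M x + (word_gf M (x\<^sup>2) * (1 / (1 - real (card A) * x))
      + word_gf M (x\<^sup>2) * (\<Sum>t\<in>T. 1 / x ^ t)))) (M \<union> (K - M))"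
    by (intro has_sum_Un_disjoint) auto
  moreover have "M \<union> (K - M) = K" using MK by auto
  ultimately show ?thesis
    by (simp add: infsumI word_gf_def[of K] M_def distrib_left)
qed


lemma word_gf_lists:
  assumes "finite A" "0 \<le> x" "real (card A) * x < 1"
  shows "word_gf (lists A) x = 1 / (1 - real (card A) * x)"
  unfolding word_gf_def by (rule infsumI[OF has_sum_lists[OF assms]])

lemma word_gf_singleton: "word_gf {w} x = x ^ length w"
  by (simp add: word_gf_def)

lemma word_gf_sandwich:
  "word_gf ((\<lambda>Z. P @ Z @ P) ` S) x = x ^ (2 * length P) * word_gf S x"
proof -
  have inj: "inj_on (\<lambda>Z. P @ Z @ P) S" by (auto intro: inj_onI)
  have eq: "((\<lambda>w. x ^ length w) \<circ> (\<lambda>Z. P @ Z @ P)) Z = x ^ (2 * length P) * x ^ length Z" for Z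
    by (simp add: power_add mult_2)
  show ?thesis
    unfolding word_gf_def infsum_reindex[OF inj] eq by (rule infsum_cmult_right')
qed

section \<open>Iterating the functional equation\<close>

text \<open>Unrolling the equation \<open>N\<close> times leaves a remainder of absolute value
  |\<phi>(x^(2^N))| times the product of the |S(x^(2^j))| for j < N. The product grows at most like
  4^N x^(-b 2^N) while \<phi> decays like x^(a 2^N), so a > b leaves at most c 4^N 4^(-2^N).\<close>

lemma sums_iterated_square:
  fixes \<phi> R S :: "real \<Rightarrow> real"
  assumes x: "0 < x" "x \<le> 1 / 4"
    and eq: "\<And>y. 0 < y \<Longrightarrow> y \<le> x \<Longrightarrow> \<phi> y = R y - \<phi> (y\<^sup>2) * S y"
    and bound: "\<And>y. 0 < y \<Longrightarrow> y \<le> x \<Longrightarrow> \<bar>\<phi> y\<bar> \<le> c * y ^ a"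
    and boundS: "\<And>y. 0 < y \<Longrightarrow> y \<le> x \<Longrightarrow> \<bar>S y\<bar> \<le> 4 / y ^ b"
    and ab: "b < a"
  shows "(\<lambda>i. (-1) ^ i * R (x ^ 2 ^ i) * (\<Prod>j<i. S (x ^ 2 ^ j))) sums \<phi> x"
proof -
  have pos: "0 < x ^ 2 ^ i" and le: "x ^ 2 ^ i \<le> x" for i
    using x power_decreasing[of 1 "2 ^ i" x] by auto
  let ?rem = "\<lambda>N. (-1) ^ N * \<phi> (x ^ 2 ^ N) * (\<Prod>j<N. S (x ^ 2 ^ j))"
  have partial: "(\<Sum>i<N. (-1) ^ i * R (x ^ 2 ^ i) * (\<Prod>j<i. S (x ^ 2 ^ j))) = \<phi> x - ?rem N" for N
  proof (induction N)
    case (Suc N)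
    have "(x ^ 2 ^ N)\<^sup>2 = x ^ 2 ^ Suc N" by (simp flip: power_mult add: mult.commute)
    then have "\<phi> (x ^ 2 ^ N) = R (x ^ 2 ^ N) - \<phi> (x ^ 2 ^ Suc N) * S (x ^ 2 ^ N)"
      using eq[OF pos le] by metis
    with Suc show ?case by (simp add: algebra_simps)
  qed simp
  \<comment> \<open>The exponents add up to \<open>b\<close> times 2^N - 1; rounding up to
    \<open>b * 2 ^ N\<close> makes the induction close by doubling.\<close>
  have prod_bound: "\<bar>\<Prod>j<N. S (x ^ 2 ^ j)\<bar> \<le> 4 ^ N / x ^ (b * 2 ^ N)" for N
  proof (induction N)
    case 0
    then show ?case using x by (simp add: power_le_one)
  next
    case (Suc N)
    have "\<bar>\<Prod>j<Suc N. S (x ^ 2 ^ j)\<bar> = \<bar>\<Prod>j<N. S (x ^ 2 ^ j)\<bar> * \<bar>S (x ^ 2 ^ N)\<bar>"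
      by (simp add: abs_mult)
    also have "\<dots> \<le> 4 ^ N / x ^ (b * 2 ^ N) * (4 / (x ^ 2 ^ N) ^ b)"
      by (intro mult_mono Suc boundS pos le) (use x in auto)
    also have "\<dots> = 4 ^ Suc N / x ^ (b * 2 ^ Suc N)"
      by (simp add: mult.commute mult_2 distrib_left power_add flip: power_mult)
    finally show ?case .
  qed
  have "c \<ge> 0"
    using bound[OF x(1) order_refl] x by (metis abs_ge_zero order_trans zero_le_mult_iff zero_less_power not_le)
  have rem_bound: "\<bar>?rem N\<bar> \<le> c * (4 ^ N * (1 / 4) ^ 2 ^ N)" for N
  proof -
    have "\<bar>?rem N\<bar> = \<bar>\<phi> (x ^ 2 ^ N)\<bar> * \<bar>\<Prod>j<N. S (x ^ 2 ^ j)\<bar>"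
      by (simp add: abs_mult power_abs)
    also have "\<dots> \<le> (c * (x ^ 2 ^ N) ^ a) * (4 ^ N / x ^ (b * 2 ^ N))"
      by (intro mult_mono bound prod_bound pos le) (use x \<open>c \<ge> 0\<close> in auto)
    \<comment> \<open>Only \<open>Suc b\<close> of the \<open>a\<close> powers are kept:
      \<open>b\<close> cancel the product and one supplies the decay.\<close>
    also have "\<dots> \<le> (c * (x ^ 2 ^ N) ^ Suc b) * (4 ^ N / x ^ (b * 2 ^ N))"
      by (intro mult_right_mono mult_left_mono power_decreasing)
        (use x \<open>c \<ge> 0\<close> ab in \<open>auto simp: power_le_one\<close>)
    also have "(x ^ 2 ^ N) ^ Suc b = x ^ 2 ^ N * x ^ (b * 2 ^ N)"
      by (simp flip: power_mult add: mult.commute)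
    also have "(c * (x ^ 2 ^ N * x ^ (b * 2 ^ N))) * (4 ^ N / x ^ (b * 2 ^ N)) = c * (4 ^ N * x ^ 2 ^ N)"
      using x by simp
    also have "\<dots> \<le> c * (4 ^ N * (1 / 4) ^ 2 ^ N)"
      by (intro mult_left_mono power_mono) (use x \<open>c \<ge> 0\<close> in auto)
    finally show ?thesis .
  qed
  have "(\<lambda>N. c * (4 ^ N * (1 / 4) ^ 2 ^ N)) \<longlonglongrightarrow> 0"
    by real_asymp
  then have "?rem \<longlonglongrightarrow> 0"
    by (rule Lim_null_comparison[rotated]) (use rem_bound in \<open>simp add: real_norm_def\<close>)
  then have "(\<lambda>N. \<phi> x - ?rem N) \<longlonglongrightarrow> \<phi> x - 0"
    by (intro tendsto_diff tendsto_const)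
  then show ?thesis unfolding sums_def partial by simp
qed

section \<open>The terms of both series at the iterated squares of q^(-2)\<close>

lemma powi_minus_power_of_two:
  fixes q :: nat
  assumes "q \<ge> 2"
  shows "real q powi (- (2 ^ (i + 1))) = (1 / (real q)\<^sup>2) ^ 2 ^ i"
    and "real q powi (1 - 2 ^ (i + 1)) = real q * (1 / (real q)\<^sup>2) ^ 2 ^ i"
proof -
  have "real q powi (2 ^ (i + 1)) = real q ^ (2 ^ (i + 1))"
    by (metis of_nat_numeral of_nat_power power_int_of_nat)
  also have "\<dots> = ((real q)\<^sup>2) ^ 2 ^ i" by (simp flip: power_mult)
  finally have eq: "real q powi (2 ^ (i + 1)) = ((real q)\<^sup>2) ^ 2 ^ i" .
  show "real q powi (- (2 ^ (i + 1))) = (1 / (real q)\<^sup>2) ^ 2 ^ i"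
    by (simp only: power_int_minus eq power_one_over inverse_eq_divide)
  show "real q powi (1 - 2 ^ (i + 1)) = real q * (1 / (real q)\<^sup>2) ^ 2 ^ i"
    using assms by (subst power_int_diff) (auto simp only: eq power_one_over power_int_1_right, auto)
qed

text \<open>Of the i + 1 denominator factors, those with k < i are distributed over the product and
  the last one goes to \<open>r_fun\<close>. This is the shape produced by
  \<open>sums_iterated_square\<close>.\<close>

lemma G_term_eq:
  assumes "q \<ge> 2"
  defines "x \<equiv> 1 / (real q)\<^sup>2"
  shows "G_term q l i = (-1) ^ i * (r_fun q l (x ^ 2 ^ i) / (1 - real q * x ^ 2 ^ i))
    * (\<Prod>j<i. s_fun q l (x ^ 2 ^ j) / (1 - real q * x ^ 2 ^ j))"
  unfolding G_term_def powi_minus_power_of_two[OF assms(1)] x_def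
  by (simp add: prod_dividef lessThan_Suc_atMost[symmetric])

lemma H_term_eq:
  assumes "q \<ge> 2"
  defines "x \<equiv> 1 / (real q)\<^sup>2"
  shows "H_term q l i = (-1) ^ i * (u_fun q l (x ^ 2 ^ i) / (1 - real q * x ^ 2 ^ i))
    * (\<Prod>j<i. v_fun q l (x ^ 2 ^ j) / (1 - real q * x ^ 2 ^ j))"
  unfolding H_term_def powi_minus_power_of_two[OF assms(1)] x_def
  by (simp add: prod_dividef lessThan_Suc_atMost[symmetric])

text \<open>Recognises the multiplier of the functional equation for \<open>T\<close> = {l};
  \<open>v_fun_div\<close> does the same for \<open>T\<close> = {l, 2l}.\<close>

lemma s_fun_div:
  assumes "0 < y" "real q * y < 1"
  shows "s_fun q l y / (1 - real q * y) = 1 / (1 - real q * y) + 1 / y ^ l"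
proof -
  have "y powi (1 - int l) = y / y ^ l" "y powi (- int l) = 1 / y ^ l"
    using assms by (simp_all add: power_int_diff power_int_minus inverse_eq_divide)
  then have "s_fun q l y = 1 + (1 - real q * y) * (1 / y ^ l)"
    by (simp add: s_fun_def left_diff_distrib diff_divide_distrib)
  then show ?thesis using assms by (simp add: add_divide_distrib)
qed

lemma v_fun_div:
  assumes "0 < y" "real q * y < 1"
  shows "v_fun q l y / (1 - real q * y) = 1 / (1 - real q * y) + (1 / y ^ l + 1 / y ^ (2 * l))"
proof -
  have int: "2 * int l = int (2 * l)" "- 2 * int l = - int (2 * l)" by auto
  have "y powi (1 - int l) = y / y ^ l" "y powi (- int l) = 1 / y ^ l"
    "y powi (1 - 2 * int l) = y / y ^ (2 * l)" "y powi (- 2 * int l) = 1 / y ^ (2 * l)"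
    unfolding int using assms
    by (simp_all del: of_nat_mult add: power_int_diff power_int_minus inverse_eq_divide)
  then have "v_fun q l y = 1 + (1 - real q * y) * (1 / y ^ l + 1 / y ^ (2 * l))"
    by (simp add: v_fun_def left_diff_distrib diff_divide_distrib distrib_left)
  then show ?thesis using assms by (simp add: add_divide_distrib)
qed

section \<open>Words bordered by a bifix-free word\<close>

locale bifix_free_word =
  fixes A :: "'a set" and L :: "'a list"
  assumes finite_A: "finite A" and L_in_lists: "L \<in> lists A"
    and L_nonempty: "L \<noteq> []" and L_bifix_free: "bifix_free L"
begin

definition C :: "'a list set" where
  "C = {W \<in> lists A. 2 * length L < length W \<and> prefix L W \<and> suffix L W}"

text \<open>The length bound lets the two copies of \<open>L @ L\<close> overlap, so
  \<open>L @ L @ L\<close> belongs to \<open>D\<close>.\<close>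

definition D :: "'a list set" where
  "D = {W \<in> lists A. 2 * length L < length W \<and> prefix (L @ L) W \<and> suffix (L @ L) W}"

lemma D_subset_C: "D \<subseteq> C"
  unfolding C_def D_def by (auto dest: append_prefixD suffix_appendD)

text \<open>A bifix shorter than \<open>L\<close> would be a bifix of \<open>L\<close>. A longer one
  has \<open>L\<close> as a bifix, and \<open>L\<close> cannot overlap itself, so it is
  \<open>L @ Z @ L\<close>, where the length bound forces \<open>Z\<close> to be empty.\<close>

lemma short_bifix_cases:
  assumes "bifix L V" "bifix U V" "length U \<le> 2 * length L"
  shows "U = L \<or> U = L @ L"
proof -
  consider "length U < length L" | "length U = length L" | "length L < length U" by linarith
  then show ?thesis
  proof cases
    case 1
    then show ?thesis using bifix_of_bifix[OF assms(2,1)] L_bifix_free by (auto simp: bifix_free_def)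
  next
    case 2
    then show ?thesis using bifix_eq_if_length_eq[OF assms(2,1)] by simp
  next
    case 3
    then have "bifix L U" by (rule bifix_of_bifix[OF assms(1,2)])
    then show ?thesis
    proof (cases rule: bifix_cases)
      case (sandwich Z)
      then show ?thesis using assms(3) by simp
    next
      case (overlap U')
      then show ?thesis using L_bifix_free by (auto simp: bifix_free_def)
    qed
  qed
qed

lemma C_bifix: "W \<in> C \<Longrightarrow> bifix L W"
  using L_nonempty by (auto simp: C_def bifix_iff)

lemma bifix_mem_C:
  assumes "W \<in> C" "bifix V W" "2 * length L < length V"
  shows "V \<in> C"
  using assms bifix_of_bifix[OF C_bifix[OF assms(1)] assms(2)] bifix_in_lists[of V W A]
  by (auto simp: C_def bifix_iff)

text \<open>\<open>V\<close> is long enough to show whether \<open>W\<close> starts and ends with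
  \<open>L @ L\<close>. Hence bifixes never cross between \<open>D\<close> and \<open>C - D\<close>:
  both are bifix-closed, and minimality can be tested in each separately.\<close>

lemma bifix_D_iff:
  assumes "V \<in> C" "bifix V W" "W \<in> lists A"
  shows "V \<in> D \<longleftrightarrow> W \<in> D"
proof -
  have V: "prefix V W" "suffix V W" "length (L @ L) \<le> length V" "2 * length L < length W"
    using assms by (auto simp: bifix_iff C_def)
  have "prefix (L @ L) V \<longleftrightarrow> prefix (L @ L) W"
    using V prefix_length_prefix prefix_order.trans by blast
  moreover have "suffix (L @ L) V \<longleftrightarrow> suffix (L @ L) W"
    using V suffix_length_suffix suffix_order.trans by blast
  ultimately show ?thesis
    using assms V(4) by (auto simp: C_def D_def)
qed

lemma bifix_closed_C: "bifix_closed A C"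
  unfolding bifix_closed_def
proof (intro conjI ballI impI)
  fix V W assume "V \<in> C" "W \<in> lists A" "bifix V W"
  then show "W \<in> C"
    using bifix_trans[OF C_bifix, of V W] bifix_length[of V W] by (auto simp: C_def bifix_iff)
qed (auto simp: C_def)

lemma bifix_closed_D: "bifix_closed A D"
  using bifix_closed_C D_subset_C bifix_D_iff unfolding bifix_closed_def by blast

lemma bifix_closed_C_diff_D: "bifix_closed A (C - D)"
  using bifix_closed_C bifix_D_iff unfolding bifix_closed_def by blast

lemma minimal_words_D: "minimal_words D = minimal_words C \<inter> D"
  using D_subset_C bifix_D_iff unfolding minimal_words_def C_def by blast

lemma minimal_words_C_diff_D: "minimal_words (C - D) = minimal_words C - D"
  using bifix_D_iff unfolding minimal_words_def C_def by blast

text \<open>A bifix longer than \<open>L @ L\<close> would itself lie in \<open>C\<close>, against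
  minimality.\<close>

lemma minimal_bifix_cases:
  assumes "V \<in> minimal_words C" "bifix U V"
  shows "U = L \<or> U = L @ L"
proof -
  have "V \<in> C" "U \<notin> C" using assms by (auto simp: minimal_words_def)
  then have "length U \<le> 2 * length L" using bifix_mem_C[of V U] assms(2) not_le by blast
  then show ?thesis using short_bifix_cases[OF C_bifix] \<open>V \<in> C\<close> assms(2) by blast
qed

lemma bifix_double_iff: "V \<in> C \<Longrightarrow> bifix (L @ L) V \<longleftrightarrow> V \<in> D"
  using L_nonempty by (auto simp: C_def D_def bifix_iff)

text \<open>This is why \<open>C\<close> is split: the functional equation needs one set
  \<open>T\<close> of bifix lengths for all minimal words, and the possible bifix
  \<open>L @ L\<close> is what distinguishes them.\<close>

lemma minimal_bifix_lengths_D: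
  assumes "V \<in> minimal_words D"
  shows "length ` {U. bifix U V} = {length L, 2 * length L}"
proof -
  have V: "V \<in> minimal_words C" "V \<in> C" "V \<in> D"
    using assms D_subset_C by (auto simp: minimal_words_D)
  have "{U. bifix U V} = {L, L @ L}"
    using minimal_bifix_cases[OF V(1)] C_bifix[OF V(2)] bifix_double_iff[OF V(2)] V(3) by auto
  then show ?thesis by (simp add: mult_2)
qed

lemma minimal_bifix_lengths_C_diff_D:
  assumes "V \<in> minimal_words (C - D)"
  shows "length ` {U. bifix U V} = {length L}"
proof -
  have V: "V \<in> minimal_words C" "V \<in> C" "V \<notin> D"
    using assms minimal_words_subset by (auto simp: minimal_words_C_diff_D)
  have "{U. bifix U V} = {L}"
    using minimal_bifix_cases[OF V(1)] C_bifix[OF V(2)] bifix_double_iff[OF V(2)] V(3) by auto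
  then show ?thesis by (simp add: mult_2)
qed

lemma C_eq: "C = (\<lambda>Z. L @ Z @ L) ` (lists A - {[]})"
proof (intro equalityI subsetI)
  fix W assume W: "W \<in> C"
  from C_bifix[OF W] show "W \<in> (\<lambda>Z. L @ Z @ L) ` (lists A - {[]})"
  proof (cases rule: bifix_cases)
    case (sandwich Z)
    then show ?thesis using W by (auto simp: C_def)
  next
    case (overlap U)
    then show ?thesis using L_bifix_free by (auto simp: bifix_free_def)
  qed
qed (use L_in_lists in \<open>auto simp: C_def prefix_def suffix_def\<close>)

text \<open>The only bifix of \<open>L @ L\<close> is \<open>L\<close>, so two copies of
  \<open>L @ L\<close> overlap only in \<open>L @ L @ L\<close>.\<close>

lemma D_eq: "D = {L @ L @ L} \<union> (\<lambda>Z. (L @ L) @ Z @ (L @ L)) ` lists A"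
proof (intro equalityI subsetI)
  fix W assume W: "W \<in> D"
  have "bifix (L @ L) W" using W D_subset_C bifix_double_iff by blast
  then show "W \<in> {L @ L @ L} \<union> (\<lambda>Z. (L @ L) @ Z @ (L @ L)) ` lists A"
  proof (cases rule: bifix_cases)
    case (sandwich Z)
    moreover have "Z \<in> lists A" using sandwich W by (auto simp: D_def)
    ultimately show ?thesis by blast
  next
    case (overlap U)
    have "bifix L (L @ L)" using bifix_sandwich[of L "[]"] L_nonempty by simp
    then have "U = L"
      using short_bifix_cases[of "L @ L" U] overlap(1) bifix_length[of U "L @ L"] by auto
    then show ?thesis using overlap by simp
  qed
next
  fix W assume "W \<in> {L @ L @ L} \<union> (\<lambda>Z. (L @ L) @ Z @ (L @ L)) ` lists A"
  then show "W \<in> D"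
  proof
    assume "W \<in> {L @ L @ L}"
    then show ?thesis using L_in_lists L_nonempty
      by (auto simp: D_def prefix_def suffix_def)
  next
    assume "W \<in> (\<lambda>Z. (L @ L) @ Z @ (L @ L)) ` lists A"
    then obtain Z where Z: "Z \<in> lists A" "W = (L @ L) @ Z @ (L @ L)" by blast
    have "prefix (L @ L) W" "suffix (L @ L) W" unfolding Z(2) by (auto simp: suffix_def)
    then show ?thesis using L_in_lists L_nonempty Z by (auto simp: D_def)
  qed
qed

section \<open>Generating functions of \<open>C\<close>, \<open>D\<close> and their minimal
  words\<close>

lemma word_gf_C:
  assumes "0 \<le> x" "real (card A) * x < 1"
  shows "word_gf C x = x ^ (2 * length L) * (1 / (1 - real (card A) * x) - 1)"
proof -
  have "word_gf ({[]} \<union> (lists A - {[]})) x = word_gf {[] :: 'a list} x + word_gf (lists A - {[]}) x"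
    by (rule word_gf_Un[OF finite_A assms]) auto
  moreover have "{[]} \<union> (lists A - {[]}) = lists A" by auto
  ultimately have "word_gf (lists A - {[]}) x = 1 / (1 - real (card A) * x) - 1"
    using word_gf_lists[OF finite_A assms] by (simp add: word_gf_singleton)
  then show ?thesis unfolding C_eq word_gf_sandwich by simp
qed

lemma word_gf_D:
  assumes "0 \<le> x" "real (card A) * x < 1"
  shows "word_gf D x = x ^ (3 * length L) + x ^ (4 * length L) / (1 - real (card A) * x)"
proof -
  have len: "length L + length L + length L = 3 * length L" "2 * (length L + length L) = 4 * length L"
    by auto
  have "length (L @ L @ L) \<noteq> length ((L @ L) @ Z @ (L @ L))" for Z
    using L_nonempty by simp
  then have "{L @ L @ L} \<inter> (\<lambda>Z. (L @ L) @ Z @ (L @ L)) ` lists A = {}"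
    by (metis (no_types, lifting) disjoint_iff imageE singletonD)
  then have "word_gf D x = word_gf {L @ L @ L} x + word_gf ((\<lambda>Z. (L @ L) @ Z @ (L @ L)) ` lists A) x"
    unfolding D_eq by (intro word_gf_Un[OF finite_A assms]) (use L_in_lists in auto)
  also have "\<dots> = x ^ (3 * length L) + x ^ (4 * length L) / (1 - real (card A) * x)"
    unfolding word_gf_sandwich word_gf_singleton word_gf_lists[OF finite_A assms]
    by (simp add: len flip: add.assoc)
  finally show ?thesis .
qed

lemma C_subset_lists: "C \<subseteq> lists A" and D_subset_lists: "D \<subseteq> lists A"
  by (auto simp: C_def D_def)

lemma word_gf_C_diff_D:
  assumes "0 \<le> x" "real (card A) * x < 1"
  shows "word_gf (C - D) x = word_gf C x - word_gf D x"
proof -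
  have "word_gf (D \<union> (C - D)) x = word_gf D x + word_gf (C - D) x"
    by (rule word_gf_Un[OF finite_A assms]) (use C_subset_lists D_subset_lists in auto)
  moreover have "D \<union> (C - D) = C" using D_subset_C by auto
  ultimately show ?thesis by simp
qed

lemma word_gf_minimal_words_C:
  assumes "0 \<le> x" "real (card A) * x < 1"
  shows "word_gf (minimal_words C) x = word_gf (minimal_words (C - D)) x + word_gf (minimal_words D) x"
proof -
  have "minimal_words C = minimal_words (C - D) \<union> minimal_words D"
    by (auto simp: minimal_words_D minimal_words_C_diff_D)
  moreover have "minimal_words (C - D) \<subseteq> lists A" "minimal_words D \<subseteq> lists A"
    using C_subset_lists D_subset_lists minimal_words_subset[of "C - D"] minimal_words_subset[of D] by auto
  moreover have "minimal_words (C - D) \<inter> minimal_words D = {}"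
    using minimal_words_subset[of "C - D"] minimal_words_subset[of D] by auto
  ultimately show ?thesis
    using word_gf_Un[OF finite_A assms] by metis
qed


text \<open>The word \<open>L @ L @ L\<close> is moved from the series of \<open>D\<close> to that of \<open>C - D\<close>: with this
  bookkeeping the inhomogeneous terms become \<open>r\<^sub>\<ell>\<close> and \<open>u\<^sub>\<ell>\<close>.\<close>

definition \<phi>\<^sub>G :: "real \<Rightarrow> real" where
  "\<phi>\<^sub>G y = word_gf (minimal_words (C - D)) y + y ^ (3 * length L)"

definition \<phi>\<^sub>H :: "real \<Rightarrow> real" where
  "\<phi>\<^sub>H y = word_gf (minimal_words D) y - y ^ (3 * length L)"

text \<open>With z = y^l, the summand z^3 in \<open>\<phi>\<^sub>G\<close> cancels the contribution
  of \<open>L @ L @ L\<close> to \<open>D\<close>, and its value z^6 at \<open>y\<^sup>2\<close> is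
  absorbed into the inhomogeneous term. What remains is a rational identity in z and p = 1 - q
  y.\<close>

lemma \<phi>\<^sub>G_equation:
  assumes y: "0 < y" "y \<le> 1" "real (card A) * y < 1"
  shows "\<phi>\<^sub>G y = r_fun (card A) (length L) y / (1 - real (card A) * y)
    - \<phi>\<^sub>G (y\<^sup>2) * (s_fun (card A) (length L) y / (1 - real (card A) * y))"
proof -
  define z p where "z = y ^ length L" and "p = 1 - real (card A) * y"
  have zp: "z > 0" "p > 0" using y by (auto simp: z_def p_def)
  have pow: "y ^ (k * length L) = z ^ k" "(y\<^sup>2) ^ (k * length L) = z ^ (2 * k)" for k
    by (simp_all add: z_def mult.commute mult.left_commute flip: power_mult)
  have fe: "word_gf C y - word_gf D y = word_gf (minimal_words (C - D)) y
      + word_gf (minimal_words (C - D)) (y\<^sup>2) * (1 / p + 1 / z)"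
    using word_gf_functional_equation[OF finite_A y bifix_closed_C_diff_D _ minimal_bifix_lengths_C_diff_D]
      word_gf_C_diff_D[of y] y by (simp add: p_def z_def)
  have gfs: "word_gf C y = z ^ 2 * (1 / p - 1)" "word_gf D y = z ^ 3 + z ^ 4 / p"
    using word_gf_C[of y] word_gf_D[of y] y by (simp_all add: pow p_def)
  have q: "real (card A) * y = 1 - p" by (simp add: p_def)
  have "r_fun (card A) (length L) y = (1 - p) * z ^ 2 - z ^ 4 + z ^ 5 - (1 - p) * z ^ 5 + z ^ 6"
    by (simp add: r_fun_def pow q[symmetric])
  moreover have "s_fun (card A) (length L) y / p = 1 / p + 1 / z"
    using s_fun_div[OF y(1,3)] by (simp add: p_def z_def)
  moreover have "z ^ 2 * (1 / p - 1) - z ^ 4 / p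
      = ((1 - p) * z ^ 2 - z ^ 4 + z ^ 5 - (1 - p) * z ^ 5 + z ^ 6) / p - z ^ 6 * (1 / p + 1 / z)"
    using zp by (simp add: field_simps power_numeral_reduce)
  ultimately show ?thesis
    using fe gfs unfolding \<phi>\<^sub>G_def p_def[symmetric] pow by (simp add: distrib_right)
qed

lemma \<phi>\<^sub>H_equation:
  assumes y: "0 < y" "y \<le> 1" "real (card A) * y < 1"
  shows "\<phi>\<^sub>H y = u_fun (card A) (length L) y / (1 - real (card A) * y)
    - \<phi>\<^sub>H (y\<^sup>2) * (v_fun (card A) (length L) y / (1 - real (card A) * y))"
proof -
  define z p where "z = y ^ length L" and "p = 1 - real (card A) * y"
  have zp: "z > 0" "p > 0" using y by (auto simp: z_def p_def)
  have pow: "y ^ (k * length L) = z ^ k" "(y\<^sup>2) ^ (k * length L) = z ^ (2 * k)" for k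
    by (simp_all add: z_def mult.commute mult.left_commute flip: power_mult)
  have fe: "word_gf D y = word_gf (minimal_words D) y
      + word_gf (minimal_words D) (y\<^sup>2) * (1 / p + (1 / z + 1 / z ^ 2))"
    using word_gf_functional_equation[OF finite_A y bifix_closed_D _ minimal_bifix_lengths_D] L_nonempty
    by (simp add: p_def z_def pow)
  have gfs: "word_gf D y = z ^ 3 + z ^ 4 / p"
    using word_gf_D[of y] y by (simp_all add: pow p_def)
  have q: "real (card A) * y = 1 - p" by (simp add: p_def)
  have "u_fun (card A) (length L) y = (1 - p) * z ^ 4 - z ^ 5 + (1 - p) * z ^ 5 - z ^ 6"
    by (simp add: u_fun_def pow q[symmetric])
  moreover have "v_fun (card A) (length L) y / p = 1 / p + (1 / z + 1 / z ^ 2)"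
    using v_fun_div[OF y(1,3)] by (simp add: p_def z_def pow)
  moreover have "z ^ 4 / p
      = ((1 - p) * z ^ 4 - z ^ 5 + (1 - p) * z ^ 5 - z ^ 6) / p + z ^ 6 * (1 / p + (1 / z + 1 / z ^ 2))"
    using zp by (simp add: field_simps power_numeral_reduce)
  ultimately show ?thesis
    using fe gfs unfolding \<phi>\<^sub>H_def p_def[symmetric] pow by (simp add: left_diff_distrib)
qed

text \<open>For 0 < y \<le> q^(-2) one has q y \<le> 1/2, so 1/(1 - q y) is at most 2, which gives
  all the constants. The larger multiplier in the case of \<open>D\<close>, of order y^(-2l), is
  matched by the decay y^(3l), as words of \<open>D\<close> have length at least 3l.\<close>

lemma G_H_term_sums:
  assumes q: "card A \<ge> 2"
  shows "(\<lambda>i. G_term (card A) (length L) i + H_term (card A) (length L) i) sums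
    word_gf (minimal_words C) (1 / (real (card A))\<^sup>2)"
proof -
  define x where "x = 1 / (real (card A))\<^sup>2"
  have q': "real (card A) \<ge> 2" using q by simp
  have x: "0 < x" "x \<le> 1 / 4"
    using q' power_mono[of 2 "real (card A)" 2] by (auto simp: x_def field_simps)
  have qx: "real (card A) * x = 1 / real (card A)" using q' by (simp add: x_def power2_eq_square)
  have qy: "real (card A) * y \<le> 1 / 2" if "y \<le> x" for y
  proof -
    have "real (card A) * y \<le> real (card A) * x" using that by (intro mult_left_mono) auto
    also have "\<dots> \<le> 1 / 2" unfolding qx using q' by (simp add: field_simps)
    finally show ?thesis .
  qed
  have inv: "1 / (1 - real (card A) * y) \<le> 2" "1 \<le> 1 / (1 - real (card A) * y)" if "0 < y" "y \<le> x" for y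
    using qy[OF that(2)] that by (auto simp: field_simps)
  have M: "0 \<le> word_gf (minimal_words K) y" "word_gf (minimal_words K) y \<le> word_gf K' y"
    if "0 < y" "y \<le> x" "K \<subseteq> K'" "K' \<subseteq> C" for y K K'
    using word_gf_mono[OF finite_A, of y "minimal_words K" K'] qy[of y] that minimal_words_subset[of K] C_subset_lists
    by auto
  have pw: "y ^ (k * length L) \<le> y ^ (m * length L)" "0 \<le> y ^ m" if "0 < y" "y \<le> x" "m \<le> k" for y k m
    using that x by (auto intro!: power_decreasing)
  have one_le: "1 \<le> 1 / y ^ k" if "0 < y" "y \<le> x" for y k
    using that x by (simp add: power_le_one)
  have "(\<lambda>i. G_term (card A) (length L) i) sums \<phi>\<^sub>G x"
    unfolding G_term_eq[OF q] x_def[symmetric]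
  proof (rule sums_iterated_square[OF x(1,2), where c = 2 and a = "2 * length L" and b = "length L"])
    fix y assume y: "0 < y" "y \<le> x"
    show "\<phi>\<^sub>G y = r_fun (card A) (length L) y / (1 - real (card A) * y)
        - \<phi>\<^sub>G (y\<^sup>2) * (s_fun (card A) (length L) y / (1 - real (card A) * y))"
      by (rule \<phi>\<^sub>G_equation) (use y x qy[of y] in auto)
    have "word_gf C y \<le> y ^ (2 * length L)"
    proof -
      have "y ^ (2 * length L) * (1 / (1 - real (card A) * y) - 1) \<le> y ^ (2 * length L) * 1"
        using inv[OF y] y by (intro mult_left_mono) auto
      then show ?thesis using word_gf_C[of y] y qy[of y] by simp
    qed
    then show "\<bar>\<phi>\<^sub>G y\<bar> \<le> 2 * y ^ (2 * length L)"
      using M[OF y, of "C - D" C] pw[OF y, of 2 3] y by (auto simp: \<phi>\<^sub>G_def)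
    have "s_fun (card A) (length L) y / (1 - real (card A) * y) = 1 / (1 - real (card A) * y) + 1 / y ^ length L"
      by (rule s_fun_div) (use y qy[of y] in auto)
    then show "\<bar>s_fun (card A) (length L) y / (1 - real (card A) * y)\<bar> \<le> 4 / y ^ length L"
      using inv[OF y] one_le[OF y, of "length L"] by (simp add: field_simps)
  qed (use L_nonempty in auto)
  moreover have "(\<lambda>i. H_term (card A) (length L) i) sums \<phi>\<^sub>H x"
    unfolding H_term_eq[OF q] x_def[symmetric]
  proof (rule sums_iterated_square[OF x(1,2), where c = 4 and a = "3 * length L" and b = "2 * length L"])
    fix y assume y: "0 < y" "y \<le> x"
    show "\<phi>\<^sub>H y = u_fun (card A) (length L) y / (1 - real (card A) * y)
        - \<phi>\<^sub>H (y\<^sup>2) * (v_fun (card A) (length L) y / (1 - real (card A) * y))"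
      by (rule \<phi>\<^sub>H_equation) (use y x qy[of y] in auto)
    have "word_gf D y \<le> 3 * y ^ (3 * length L)"
    proof -
      have "y ^ (4 * length L) * (1 / (1 - real (card A) * y)) \<le> y ^ (3 * length L) * 2"
        using inv[OF y] y pw[OF y, of 3 4] qy[OF y(2)] by (intro mult_mono) auto
      then show ?thesis using word_gf_D[of y] y qy[of y] by simp
    qed
    then show "\<bar>\<phi>\<^sub>H y\<bar> \<le> 4 * y ^ (3 * length L)"
      using M[OF y, of D D] D_subset_C pw[OF y, of "3 * length L" "3 * length L"] y by (auto simp: \<phi>\<^sub>H_def)
    have "v_fun (card A) (length L) y / (1 - real (card A) * y)
        = 1 / (1 - real (card A) * y) + (1 / y ^ length L + 1 / y ^ (2 * length L))"
      by (rule v_fun_div) (use y qy[of y] in auto)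
    moreover have "1 / y ^ length L \<le> 1 / y ^ (2 * length L)"
      using y x by (intro divide_left_mono power_decreasing) auto
    moreover have "4 / y ^ (2 * length L) = 4 * (1 / y ^ (2 * length L))" by simp
    ultimately show "\<bar>v_fun (card A) (length L) y / (1 - real (card A) * y)\<bar> \<le> 4 / y ^ (2 * length L)"
      using inv[OF y] one_le[OF y, of "length L"] one_le[OF y, of "2 * length L"] by linarith
  qed (use L_nonempty in auto)
  ultimately have "(\<lambda>i. G_term (card A) (length L) i + H_term (card A) (length L) i) sums (\<phi>\<^sub>G x + \<phi>\<^sub>H x)"
    by (rule sums_add)
  \<comment> \<open>The corrections by \<open>x ^ (3 * length L)\<close> cancel.\<close>
  moreover have "\<phi>\<^sub>G x + \<phi>\<^sub>H x = word_gf (minimal_words C) x"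
    using word_gf_minimal_words_C[of x] x qy[of x] by (simp add: \<phi>\<^sub>G_def \<phi>\<^sub>H_def)
  ultimately show ?thesis by (simp add: x_def)
qed

end

section \<open>Instances of the second and third Zimin words\<close>

definition Z2_words :: "'a set \<Rightarrow> 'a list set" where
  "Z2_words A = {W \<in> lists A. \<exists>X Y. X \<noteq> [] \<and> Y \<noteq> [] \<and> W = X @ Y @ X}"

definition bifix_free_words :: "'a set \<Rightarrow> 'a list set" where
  "bifix_free_words A = {L \<in> lists A. L \<noteq> [] \<and> bifix_free L}"

lemma bifix_free_wordI:
  "finite A \<Longrightarrow> L \<in> bifix_free_words A \<Longrightarrow> bifix_free_word A L"
  by unfold_locales (auto simp: bifix_free_words_def)

lemma Z2_words_iff:
  "W \<in> Z2_words A \<longleftrightarrow> W \<in> lists A \<and> (\<exists>X. bifix X W \<and> 2 * length X < length W)"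
proof
  assume "W \<in> Z2_words A"
  then obtain X Y where XY: "W \<in> lists A" "X \<noteq> []" "Y \<noteq> []" "W = X @ Y @ X"
    unfolding Z2_words_def by blast
  then have "bifix X W" "2 * length X < length W" using bifix_sandwich[of X Y] by auto
  then show "W \<in> lists A \<and> (\<exists>X. bifix X W \<and> 2 * length X < length W)" using XY(1) by blast
next
  assume *: "W \<in> lists A \<and> (\<exists>X. bifix X W \<and> 2 * length X < length W)"
  then obtain X where X: "bifix X W" "2 * length X < length W" by blast
  from X(1) show "W \<in> Z2_words A"
  proof (cases rule: bifix_cases)
    case (sandwich Z)
    have "X \<noteq> []" using X by (simp add: bifix_iff)
    moreover have "Z \<noteq> []" using X(2) sandwich by auto
    ultimately show ?thesis using sandwich * unfolding Z2_words_def by blast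
  next
    case (overlap U)
    then show ?thesis using X(2) by simp
  qed
qed

lemma bifix_closed_Z2_words: "bifix_closed A (Z2_words A)"
  unfolding bifix_closed_def
proof (intro conjI ballI impI)
  fix V W assume V: "V \<in> Z2_words A" and W: "W \<in> lists A" "bifix V W"
  then obtain X where X: "bifix X V" "2 * length X < length V" by (auto simp: Z2_words_iff)
  have "bifix X W" using bifix_trans[OF X(1) W(2)] .
  moreover have "2 * length X < length W" using X(2) bifix_length[OF W(2)] by linarith
  ultimately show "W \<in> Z2_words A" using W(1) by (auto simp: Z2_words_iff)
qed (auto simp: Z2_words_def)

text \<open>Descend to shorter bifixes. The length bound guarantees that the bifix-free bifix of an
  instance of aba occurs at both ends without filling the word, as \<open>C\<close>
  requires.\<close>

lemma ex_bifix_free_bifix: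
  "bifix X W \<Longrightarrow> \<exists>L. bifix L W \<and> bifix_free L \<and> length L \<le> length X"
proof (induction "length X" arbitrary: X rule: less_induct)
  case less
  show ?case
  proof (cases "bifix_free X")
    case False
    then obtain U where U: "bifix U X" by (auto simp: bifix_free_def)
    with less.hyps[of U] bifix_trans[OF U less.prems] bifix_length[OF U] show ?thesis
      by (meson less_imp_le order_trans)
  qed (use less.prems in auto)
qed

lemma bifix_free_bifix_unique:
  assumes "bifix L W" "bifix L' W" "bifix_free L" "bifix_free L'"
  shows "L = L'"
  using assms bifix_of_bifix[of L W L'] bifix_of_bifix[of L' W L] bifix_eq_if_length_eq[of L W L']
  unfolding bifix_free_def by (meson linorder_neqE_nat)

lemma (in bifix_free_word) C_iff: "W \<in> C \<longleftrightarrow> W \<in> lists A \<and> bifix L W \<and> 2 * length L < length W"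
  using C_bifix[of W] by (auto simp: C_def bifix_iff)

text \<open>\<open>C\<close> consists of the instances of aba with bifix \<open>L\<close>. Any
  instance of aba that is a bifix of such a word inherits \<open>L\<close> by uniqueness, so
  minimality in \<open>C\<close> and in \<open>Z2_words A\<close> agree.\<close>

lemma (in bifix_free_word) minimal_words_C: "minimal_words C = {V \<in> minimal_words (Z2_words A). bifix L V}"
proof -
  have C: "V \<in> C \<longleftrightarrow> V \<in> Z2_words A \<and> bifix L V" for V
  proof
    assume "V \<in> Z2_words A \<and> bifix L V"
    then obtain X where V: "V \<in> lists A" "bifix L V" "bifix X V" "2 * length X < length V"
      by (auto simp: Z2_words_iff)
    then obtain L' where L': "bifix L' V" "bifix_free L'" "length L' \<le> length X"
      using ex_bifix_free_bifix by blast
    then have "L' = L" using bifix_free_bifix_unique V(2) L_bifix_free by blast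
    then show "V \<in> C" using V L'(3) by (auto simp: C_iff)
  qed (auto simp: C_iff Z2_words_iff)
  have "bifix L U" if "U \<in> Z2_words A" "bifix U V" "bifix L V" for U V
  proof -
    from that(1) obtain X where "bifix X U" by (auto simp: Z2_words_iff)
    then obtain L' where L': "bifix L' U" "bifix_free L'" using ex_bifix_free_bifix by blast
    then have "L' = L"
      using bifix_free_bifix_unique bifix_trans[OF L'(1) that(2)] that(3) L_bifix_free by blast
    then show ?thesis using L'(1) by simp
  qed
  then show ?thesis unfolding minimal_words_def using C by auto
qed

lemma Z3_instance_iff:
  assumes "U \<in> lists A"
  shows "Z3_instance U \<longleftrightarrow> (\<exists>V\<in>minimal_words (Z2_words A). \<exists>Z\<in>lists A. Z \<noteq> [] \<and> U = V @ Z @ V)"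
proof
  assume "Z3_instance U"
  then obtain X Y Z where XYZ: "X \<noteq> []" "Y \<noteq> []" "Z \<noteq> []" "U = X @ Y @ X @ Z @ X @ Y @ X"
    unfolding Z3_instance_def by blast
  define V where "V = X @ Y @ X"
  have U: "U = V @ Z @ V" using XYZ by (simp add: V_def)
  have V: "V \<in> Z2_words A" using XYZ assms by (auto simp: V_def Z2_words_def)
  have bV: "bifix V U" unfolding U using XYZ by (intro bifix_sandwich) (simp add: V_def)
  have "U \<in> Z2_words A" using V bV bifix_closed_Z2_words assms unfolding bifix_closed_def by blast
  moreover have "U \<notin> minimal_words (Z2_words A)" using V bV by (auto simp: minimal_words_def)
  ultimately obtain V' where V': "V' \<in> minimal_words (Z2_words A)" "bifix V' U"
    using ex_minimal_bifix by blast
  \<comment> \<open>Otherwise \<open>V\<close> would be a bifix of the minimal word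
    \<open>V'\<close>. So the two copies of \<open>V'\<close> in \<open>U\<close> lie apart and the
    middle word is nonempty.\<close>
  have "length V' \<le> length V"
    using V' V bifix_of_bifix[OF bV V'(2)] unfolding minimal_words_def by (auto simp: not_le[symmetric])
  then have len: "2 * length V' < length U" using XYZ(3) by (cases Z) (simp_all add: U)
  from V'(2) show "\<exists>V\<in>minimal_words (Z2_words A). \<exists>Z\<in>lists A. Z \<noteq> [] \<and> U = V @ Z @ V"
  proof (cases rule: bifix_cases)
    case (sandwich Z')
    then have "Z' \<noteq> []" "Z' \<in> lists A" using len assms by auto
    then show ?thesis using sandwich V'(1) by blast
  next
    case (overlap U')
    then show ?thesis using len by simp
  qed
next
  assume "\<exists>V\<in>minimal_words (Z2_words A). \<exists>Z\<in>lists A. Z \<noteq> [] \<and> U = V @ Z @ V"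
  then obtain V Z where "V \<in> Z2_words A" "Z \<noteq> []" "U = V @ Z @ V"
    using minimal_words_subset by blast
  moreover from this obtain X Y where "X \<noteq> []" "Y \<noteq> []" "V = X @ Y @ X"
    unfolding Z2_words_def by blast
  moreover from calculation have "U = X @ Y @ X @ Z @ X @ Y @ X" by simp
  ultimately show "Z3_instance U" unfolding Z3_instance_def by blast
qed

section \<open>Probabilities at finite length and their limit\<close>

lemma finite_words: "finite (words q n)" and card_words: "card (words q n) = q ^ n"
proof -
  have "words q n = {w. set w \<subseteq> {1..q} \<and> length w = n}" by (auto simp: words_def)
  then show "finite (words q n)" "card (words q n) = q ^ n"
    using finite_lists_length_eq[of "{1..q}" n] card_lists_length_eq[of "{1..q}" n] by auto
qed

text \<open>Each minimal \<open>V\<close> leaves q^(n - 2|V|) choices for the middle, and different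
  pairs give different words. The strict inequality keeps the middle nonempty.\<close>

lemma Z3_prob_eq:
  assumes q: "q \<ge> 2"
  shows "Z3_prob q n
    = (\<Sum>V | V \<in> minimal_words (Z2_words {1..q}) \<and> 2 * length V < n. (1 / (real q)\<^sup>2) ^ length V)"
    and "finite {V \<in> minimal_words (Z2_words {1..q}). 2 * length V < n}"
proof -
  define M where "M = minimal_words (Z2_words {1..q})"
  define S where "S = {V \<in> M. 2 * length V < n}"
  have M: "M \<subseteq> lists {1..q}" "M \<subseteq> Z2_words {1..q}"
    unfolding M_def using minimal_words_subset[of "Z2_words {1..q}"] by (auto simp: Z2_words_def)
  have "S \<subseteq> {w. set w \<subseteq> {1..q} \<and> length w \<le> n}" using M by (auto simp: S_def)
  then have finS: "finite S" using finite_lists_length_le[of "{1..q}" n] finite_subset by blast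
  then show "finite {V \<in> minimal_words (Z2_words {1..q}). 2 * length V < n}" by (simp add: S_def M_def)
  have eq: "words q n \<inter> {U. Z3_instance U}
      = (\<lambda>(V, Z). V @ Z @ V) ` (SIGMA V:S. words q (n - 2 * length V))"
  proof (intro equalityI subsetI)
    fix U assume "U \<in> words q n \<inter> {U. Z3_instance U}"
    then have U: "U \<in> lists {1..q}" "length U = n" "Z3_instance U" by (auto simp: words_def)
    then obtain V Z where VZ: "V \<in> M" "Z \<in> lists {1..q}" "Z \<noteq> []" "U = V @ Z @ V"
      using Z3_instance_iff[OF U(1)] unfolding M_def by blast
    then have "V \<in> S" "Z \<in> words q (n - 2 * length V)" using U(2) by (auto simp: S_def words_def)
    then show "U \<in> (\<lambda>(V, Z). V @ Z @ V) ` (SIGMA V:S. words q (n - 2 * length V))"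
      using VZ(4) by force
  next
    fix U assume "U \<in> (\<lambda>(V, Z). V @ Z @ V) ` (SIGMA V:S. words q (n - 2 * length V))"
    then obtain V Z where VZ: "V \<in> S" "Z \<in> words q (n - 2 * length V)" "U = V @ Z @ V" by auto
    then have "U \<in> words q n" "Z \<noteq> []" "Z \<in> lists {1..q}" "V \<in> M" using M by (auto simp: words_def S_def)
    moreover from this have "Z3_instance U"
      using Z3_instance_iff[of U "{1..q}"] VZ(3) unfolding M_def words_def by blast
    ultimately show "U \<in> words q n \<inter> {U. Z3_instance U}" by blast
  qed
  have inj: "inj_on (\<lambda>(V, Z). V @ Z @ V) (SIGMA V:S. words q (n - 2 * length V))"
    by (rule inj_on_subset[OF inj_on_sandwich[of "Z2_words {1..q}"]]) (auto simp: S_def M_def Z2_words_def)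
  have card: "card (words q n \<inter> {U. Z3_instance U}) = (\<Sum>V\<in>S. q ^ (n - 2 * length V))"
    unfolding eq card_image[OF inj] by (subst card_SigmaI) (auto simp: finS finite_words card_words)
  have "card (words q n) \<noteq> 0" using q by (simp add: card_words)
  then have ne: "words q n \<noteq> {}" by auto
  have "Z3_prob q n = real (card (words q n \<inter> {U. Z3_instance U})) / real (card (words q n))"
    unfolding Z3_prob_def by (rule measure_pmf_of_set[OF ne finite_words])
  also have "\<dots> = (\<Sum>V\<in>S. real q ^ (n - 2 * length V) / real q ^ n)"
    by (simp add: card card_words sum_divide_distrib)
  also have "\<dots> = (\<Sum>V\<in>S. (1 / (real q)\<^sup>2) ^ length V)"
  proof (rule sum.cong[OF refl])
    fix V assume "V \<in> S"
    then have "2 * length V \<le> n" by (simp add: S_def)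
    then have "real q ^ (n - 2 * length V) * ((real q)\<^sup>2) ^ length V = real q ^ n"
      by (simp flip: power_mult power_add)
    then show "real q ^ (n - 2 * length V) / real q ^ n = (1 / (real q)\<^sup>2) ^ length V"
      using q by (auto simp: power_one_over field_simps)
  qed
  finally show "Z3_prob q n
    = (\<Sum>V | V \<in> minimal_words (Z2_words {1..q}) \<and> 2 * length V < n. (1 / (real q)\<^sup>2) ^ length V)"
    by (simp add: S_def M_def)
qed

text \<open>The index sets in \<open>Z3_prob_eq\<close> are finite and eventually contain every
  finite set of minimal words, so the probabilities run along the filter that defines the unordered
  sum.\<close>

lemma Z3_prob_tendsto:
  assumes q: "q \<ge> 2"
  shows "Z3_prob q \<longlonglongrightarrow> word_gf (minimal_words (Z2_words {1..q})) (1 / (real q)\<^sup>2)"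
proof -
  define M where "M = minimal_words (Z2_words {1..q})"
  define x where "x = 1 / (real q)\<^sup>2"
  have x: "0 \<le> x" "real (card {1..q}) * x < 1" using q by (auto simp: x_def power2_eq_square)
  have "M \<subseteq> lists {1..q}"
    unfolding M_def using minimal_words_subset[of "Z2_words {1..q}"] by (auto simp: Z2_words_def)
  then have "((\<lambda>w. x ^ length w) has_sum word_gf M x) M"
    by (intro has_sum_word_gf[OF _ x]) auto
  then have lim: "(sum (\<lambda>w. x ^ length w) \<longlongrightarrow> word_gf M x) (finite_subsets_at_top M)"
    by (simp add: has_sum_def)
  have "filterlim (\<lambda>n. {V \<in> M. 2 * length V < n}) (finite_subsets_at_top M) sequentially"
    unfolding filterlim_finite_subsets_at_top
  proof (intro allI impI)
    fix X assume X: "finite X \<and> X \<subseteq> M"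
    obtain N where N: "\<And>V. V \<in> X \<Longrightarrow> length V \<le> N"
      using X by (metis finite_imageI finite_nat_set_iff_bounded_le imageI)
    show "\<forall>\<^sub>F n in sequentially. finite {V \<in> M. 2 * length V < n} \<and> X \<subseteq> {V \<in> M. 2 * length V < n}
        \<and> {V \<in> M. 2 * length V < n} \<subseteq> M"
    proof (rule eventually_sequentiallyI[of "2 * N + 1"])
      fix n assume "2 * N + 1 \<le> n"
      then have "X \<subseteq> {V \<in> M. 2 * length V < n}" using X N by fastforce
      then show "finite {V \<in> M. 2 * length V < n} \<and> X \<subseteq> {V \<in> M. 2 * length V < n}
        \<and> {V \<in> M. 2 * length V < n} \<subseteq> M"
        using Z3_prob_eq(2)[OF q, of n] by (auto simp: M_def)
    qed
  qed
  from filterlim_compose[OF lim this] show ?thesis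
    unfolding Z3_prob_eq(1)[OF q] M_def x_def .
qed

text \<open>The minimal words are grouped by their unique bifix-free bifix \<open>L\<close>, then by
  the length of \<open>L\<close>. The inner sum depends on that length alone, so it is counted
  \<open>num_bifix_free\<close> times.\<close>

lemma num_bifix_free_series:
  assumes q: "q \<ge> 2"
  shows "(\<lambda>l. real (num_bifix_free q (Suc l)) * (\<Sum>i. G_term q (Suc l) i + H_term q (Suc l) i))
    sums word_gf (minimal_words (Z2_words {1..q})) (1 / (real q)\<^sup>2)"
proof -
  define M where "M = minimal_words (Z2_words {1..q})"
  define x where "x = 1 / (real q)\<^sup>2"
  define B where "B l = {w \<in> words q (Suc l). bifix_free w}" for l
  have x: "0 \<le> x" "real (card {1..q}) * x < 1" using q by (auto simp: x_def power2_eq_square)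
  have B: "B l \<subseteq> bifix_free_words {1..q}" "finite (B l)" "card (B l) = num_bifix_free q (Suc l)" for l
  proof -
    show "finite (B l)" unfolding B_def using finite_words by (rule finite_subset[rotated]) auto
  qed (auto simp: B_def words_def bifix_free_words_def num_bifix_free_def)
  have "M \<subseteq> lists {1..q}"
    unfolding M_def using minimal_words_subset[of "Z2_words {1..q}"] by (auto simp: Z2_words_def)
  then have M: "((\<lambda>w. x ^ length w) has_sum word_gf M x) M"
    by (intro has_sum_word_gf[OF _ x]) auto
  have "bij_betw snd (SIGMA L:bifix_free_words {1..q}. {V \<in> M. bifix L V}) M"
  proof (rule bij_betw_imageI)
    show "inj_on snd (SIGMA L:bifix_free_words {1..q}. {V \<in> M. bifix L V})"
      by (rule inj_onI) (auto simp: bifix_free_words_def intro: bifix_free_bifix_unique)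
    show "snd ` (SIGMA L:bifix_free_words {1..q}. {V \<in> M. bifix L V}) = M"
    proof (intro equalityI subsetI)
      fix V assume V: "V \<in> M"
      then have "V \<in> Z2_words {1..q}" using minimal_words_subset unfolding M_def by blast
      then obtain X where X: "bifix X V" "V \<in> lists {1..q}" by (auto simp: Z2_words_iff)
      then obtain L where L: "bifix L V" "bifix_free L" using ex_bifix_free_bifix by blast
      then have "L \<in> bifix_free_words {1..q}"
        using bifix_in_lists[OF L(1) X(2)] by (auto simp: bifix_free_words_def bifix_iff)
      then show "V \<in> snd ` (SIGMA L:bifix_free_words {1..q}. {V \<in> M. bifix L V})"
        using L V by force
    qed auto
  qed
  from has_sum_reindex_bij_betw[OF this, THEN iffD2, OF M]
  have sum1: "((\<lambda>(L, w). x ^ length w) has_sum word_gf M x)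
      (SIGMA L:bifix_free_words {1..q}. {V \<in> M. bifix L V})"
    by (simp add: case_prod_unfold)
  have GH: "(\<lambda>i. G_term q (length L) i + H_term q (length L) i) sums word_gf {V \<in> M. bifix L V} x"
    if "L \<in> bifix_free_words {1..q}" for L
  proof -
    interpret bifix_free_word "{1..q}" L using that by (intro bifix_free_wordI) auto
    show ?thesis using G_H_term_sums q unfolding minimal_words_C M_def x_def by simp
  qed
  have "((\<lambda>L. word_gf {V \<in> M. bifix L V} x) has_sum word_gf M x) (bifix_free_words {1..q})"
    by (rule has_sum_SigmaD[OF sum1])
      (use \<open>M \<subseteq> lists {1..q}\<close> in \<open>auto intro!: has_sum_word_gf[OF _ x]\<close>)
  then have sum2: "((\<lambda>L. \<Sum>i. G_term q (length L) i + H_term q (length L) i) has_sum word_gf M x)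
      (bifix_free_words {1..q})"
    by (rule has_sum_cong[THEN iffD1, rotated]) (use GH in \<open>auto dest: sums_unique\<close>)
  have "bij_betw snd (Sigma UNIV B) (bifix_free_words {1..q})"
  \<comment> \<open>Bifix-free words here are nonempty, so index l stands for length
    \<open>Suc l\<close>.\<close>
  proof (rule bij_betwI[where g = "\<lambda>L. (length L - 1, L)"])
    show "snd \<in> Sigma UNIV B \<rightarrow> bifix_free_words {1..q}" using B(1) by fastforce
  qed (auto simp: B_def words_def bifix_free_words_def)
  from has_sum_reindex_bij_betw[OF this, THEN iffD2, OF sum2]
  have sum3: "((\<lambda>(l, L). \<Sum>i. G_term q (length L) i + H_term q (length L) i) has_sum word_gf M x)
      (Sigma UNIV B)"
    by (simp add: case_prod_unfold)
  have "((\<lambda>l. real (num_bifix_free q (Suc l)) * (\<Sum>i. G_term q (Suc l) i + H_term q (Suc l) i))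
      has_sum word_gf M x) UNIV"
  proof (rule has_sum_SigmaD[OF sum3])
    fix l
    have len: "length L = Suc l" if "L \<in> B l" for L using that by (simp add: B_def words_def)
    show "((\<lambda>L. case (l, L) of (l, L) \<Rightarrow> \<Sum>i. G_term q (length L) i + H_term q (length L) i) has_sum
        real (num_bifix_free q (Suc l)) * (\<Sum>i. G_term q (Suc l) i + H_term q (Suc l) i)) (B l)"
      by (rule has_sum_finiteI[OF B(2)]) (simp add: len B(3))
  qed
  then show ?thesis unfolding M_def x_def by (rule has_sum_imp_sums)
qed

text \<open>Provides a bifix-free word of every positive length over two letters, so that
  summability of the inner series can be read off from the locale for each l. A bifix would begin
  with 2, yet lie inside the block of ones.\<close>

lemma bifix_free_Cons_replicate: "bifix_free (2 # replicate n (1 :: nat))"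
proof -
  have False if "bifix V (2 # replicate n (1 :: nat))" for V
  proof -
    from that obtain A B where AB: "V \<noteq> []" "B \<noteq> []"
      "2 # replicate n 1 = V @ A" "2 # replicate n (1 :: nat) = B @ V"
      unfolding bifix_def by blast
    have "hd V = 2" using AB(1,3) by (metis hd_append2 list.sel(1))
    moreover have "replicate n (1 :: nat) = tl B @ V" using AB(2,4) by (metis list.sel(3) tl_append2)
    then have "hd V \<in> set (replicate n (1 :: nat))" using AB(1) by auto
    ultimately show False by (auto split: if_splits)
  qed
  then show ?thesis by (auto simp: bifix_free_def)
qed

theorem theorem4p3:
  fixes q :: nat
  assumes "q \<ge> 2"
  shows "convergent (Z3_prob q)
    \<and> (\<forall>l\<ge>1. summable (\<lambda>i. G_term q l i + H_term q l i))
    \<and> summable (\<lambda>l. real (num_bifix_free q (Suc l))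
          * (\<Sum>i. G_term q (Suc l) i + H_term q (Suc l) i))
    \<and> Z3_density q = (\<Sum>l. real (num_bifix_free q (Suc l))
          * (\<Sum>i. G_term q (Suc l) i + H_term q (Suc l) i))"
proof (intro conjI allI impI)
  note lim = Z3_prob_tendsto[OF assms] and series = num_bifix_free_series[OF assms]
  show "convergent (Z3_prob q)" using lim by (rule convergentI)
  show "summable (\<lambda>l. real (num_bifix_free q (Suc l))
      * (\<Sum>i. G_term q (Suc l) i + H_term q (Suc l) i))"
    using series by (rule sums_summable)
  show "Z3_density q = (\<Sum>l. real (num_bifix_free q (Suc l))
      * (\<Sum>i. G_term q (Suc l) i + H_term q (Suc l) i))"
    unfolding Z3_density_def using limI[OF lim] sums_unique[OF series] by simp
  fix l :: nat assume "l \<ge> 1"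
  define L where "L = 2 # replicate (l - 1) (1 :: nat)"
  interpret bifix_free_word "{1..q}" L
    by unfold_locales (use assms bifix_free_Cons_replicate in \<open>auto simp: L_def\<close>)
  have "length L = l" using \<open>l \<ge> 1\<close> by (simp add: L_def)
  then show "summable (\<lambda>i. G_term q l i + H_term q l i)"
    using sums_summable[OF G_H_term_sums] assms by simp
qed

end
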